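(* Smooth solutions of the compressible Euler equations for a polytropic ideal gas, $$\tau_t-u_x=0,\qquad u_t+p_x=0,\qquad \left(\tfrac12u^2+e\right)_t+(up)_x=0,$$ satisfy $$\alpha'=k_1\left\{k_2(3\alpha+\beta)+\alpha\beta-\alpha^2\right\}$$ and $$\beta^{\backprime}=k_1\left\{-k_2(\alpha+3\beta)+\alpha\beta-\beta^2\right\},$$ where $$k_1=\frac{(\gamma+1)K_c}{2(\gamma-1)}\,z^{\frac{2}{\gamma-1}},\qquad k_2=\frac{\gamma-1}{\gamma(\gamma+1)}\,z\,m_x,$$ and $K_c$ is the positive constant given in the context.
   Context: Unknowns are functions of $(t,x)$, with one space dimension $x$ in Lagrangian coordinates: $\tau=\rho^{-1}>0$ is the specific volume ($\rho$ is the density), $u$ the velocity, $S$ the entropy, $p$ the pressure, $e$ the internal energy. Polytropic ideal gas: $p=Ke^{S/c_v}\tau^{-\gamma}$ and $e=\frac{1}{\gamma-1}p\tau$, where $K,c_v>0$ and $\gamma>1$ are fixed constants. For $C^1$ solutions the energy equation is equivalently replaced by $S_t=0$. New variables: $z=\frac{2\sqrt{K\gamma}}{\gamma-1}\tau^{-\frac{\gamma-1}{2}}$ and $m=e^{\frac{S}{2c_v}}$. A solution is smooth if $u,\tau,S$ are $C^2$ (equivalently $u,z,m$ are $C^2$ with $z,m$ both positive). The wave speed is $c=\sqrt{-p_\tau}=K_c\,m\,z^{\frac{\gamma+1}{\gamma-1}}$, where $K_c=\sqrt{K\gamma}\,K_\tau^{-\frac{\gamma+1}{2}}>0$ and $K_\tau=\left(\frac{2\sqrt{K\gamma}}{\gamma-1}\right)^{\frac{2}{\gamma-1}}$.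 Directional derivatives along forward and backward characteristics: $'=\partial_t+c\,\partial_x$ and ${}^{\backprime}=\partial_t-c\,\partial_x$. The variables $\alpha,\beta$ are $\alpha=-\frac{p^{\backprime}}{c^2}=u_x+mz_x+\frac{\gamma-1}{\gamma}m_xz$ and $\beta=-\frac{p'}{c^2}=u_x-mz_x-\frac{\gamma-1}{\gamma}m_xz$. *)

theory Defs
  imports "HOL-Analysis.Analysis"
begin

section \<open>Partial derivatives in the (t,x)-plane\<close>

text \<open>A field is a function of the point \<open>w = (t, x)\<close>.\<close>

definition d_t :: "(real \<times> real \<Rightarrow> real) \<Rightarrow> real \<times> real \<Rightarrow> real" where
  "d_t f = (\<lambda>(t, x). deriv (\<lambda>s. f (s, x)) t)"

definition d_x :: "(real \<times> real \<Rightarrow> real) \<Rightarrow> real \<times> real \<Rightarrow> real" where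
  "d_x f = (\<lambda>(t, x). deriv (\<lambda>y. f (t, y)) x)"

definition C1_on :: "(real \<times> real) set \<Rightarrow> (real \<times> real \<Rightarrow> real) \<Rightarrow> bool" where
  "C1_on \<Omega> f \<longleftrightarrow>
     (\<forall>(t, x)\<in>\<Omega>. (\<lambda>s. f (s, x)) differentiable (at t) \<and> (\<lambda>y. f (t, y)) differentiable (at x)) \<and>
     continuous_on \<Omega> (d_t f) \<and> continuous_on \<Omega> (d_x f)"

definition C2_on :: "(real \<times> real) set \<Rightarrow> (real \<times> real \<Rightarrow> real) \<Rightarrow> bool" where
  "C2_on \<Omega> f \<longleftrightarrow> C1_on \<Omega> f \<and> C1_on \<Omega> (d_t f) \<and> C1_on \<Omega> (d_x f)"

section \<open>Polytropic ideal gas in Lagrangian coordinates\<close>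

definition pressure :: "real \<Rightarrow> real \<Rightarrow> real \<Rightarrow> real \<Rightarrow> real \<Rightarrow> real" where
  "pressure K cv \<gamma> \<tau> S = K * exp (S / cv) * \<tau> powr (- \<gamma>)"

definition internal_energy :: "real \<Rightarrow> real \<Rightarrow> real \<Rightarrow> real \<Rightarrow> real \<Rightarrow> real" where
  "internal_energy K cv \<gamma> \<tau> S = pressure K cv \<gamma> \<tau> S * \<tau> / (\<gamma> - 1)"

definition wave_speed :: "real \<Rightarrow> real \<Rightarrow> real \<Rightarrow> real \<Rightarrow> real \<Rightarrow> real" where
  "wave_speed K cv \<gamma> \<tau> S = sqrt (- deriv (\<lambda>v. pressure K cv \<gamma> v S) \<tau>)"

text \<open>The same quantities along a given state \<open>(\<tau>, S)\<close> of fields.\<close>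

definition p_field :: "real \<Rightarrow> real \<Rightarrow> real \<Rightarrow> (real \<times> real \<Rightarrow> real) \<Rightarrow> (real \<times> real \<Rightarrow> real)
    \<Rightarrow> real \<times> real \<Rightarrow> real" where
  "p_field K cv \<gamma> \<tau> S = (\<lambda>w. pressure K cv \<gamma> (\<tau> w) (S w))"

definition e_field :: "real \<Rightarrow> real \<Rightarrow> real \<Rightarrow> (real \<times> real \<Rightarrow> real) \<Rightarrow> (real \<times> real \<Rightarrow> real)
    \<Rightarrow> real \<times> real \<Rightarrow> real" where
  "e_field K cv \<gamma> \<tau> S = (\<lambda>w. internal_energy K cv \<gamma> (\<tau> w) (S w))"

definition c_field :: "real \<Rightarrow> real \<Rightarrow> real \<Rightarrow> (real \<times> real \<Rightarrow> real) \<Rightarrow> (real \<times> real \<Rightarrow> real)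
    \<Rightarrow> real \<times> real \<Rightarrow> real" where
  "c_field K cv \<gamma> \<tau> S = (\<lambda>w. wave_speed K cv \<gamma> (\<tau> w) (S w))"

definition z_field :: "real \<Rightarrow> real \<Rightarrow> (real \<times> real \<Rightarrow> real) \<Rightarrow> real \<times> real \<Rightarrow> real" where
  "z_field K \<gamma> \<tau> = (\<lambda>w. 2 * sqrt (K * \<gamma>) / (\<gamma> - 1) * \<tau> w powr (- ((\<gamma> - 1) / 2)))"

definition m_field :: "real \<Rightarrow> (real \<times> real \<Rightarrow> real) \<Rightarrow> real \<times> real \<Rightarrow> real" where
  "m_field cv S = (\<lambda>w. exp (S w / (2 * cv)))"

definition K_tau :: "real \<Rightarrow> real \<Rightarrow> real" where
  "K_tau K \<gamma> = (2 * sqrt (K * \<gamma>) / (\<gamma> - 1)) powr (2 / (\<gamma> - 1))"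

definition K_c :: "real \<Rightarrow> real \<Rightarrow> real" where
  "K_c K \<gamma> = sqrt (K * \<gamma>) * K_tau K \<gamma> powr (- ((\<gamma> + 1) / 2))"

section \<open>Smooth solutions of the compressible Euler equations\<close>

definition smooth_euler_solution :: "real \<Rightarrow> real \<Rightarrow> real \<Rightarrow> (real \<times> real) set
    \<Rightarrow> (real \<times> real \<Rightarrow> real) \<Rightarrow> (real \<times> real \<Rightarrow> real) \<Rightarrow> (real \<times> real \<Rightarrow> real) \<Rightarrow> bool" where
  "smooth_euler_solution K cv \<gamma> \<Omega> \<tau> u S \<longleftrightarrow>
     open \<Omega> \<and> C2_on \<Omega> \<tau> \<and> C2_on \<Omega> u \<and> C2_on \<Omega> S \<and>
     (\<forall>w\<in>\<Omega>. 0 < \<tau> w \<and>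
        d_t \<tau> w - d_x u w = 0 \<and>
        d_t u w + d_x (p_field K cv \<gamma> \<tau> S) w = 0 \<and>
        d_t (\<lambda>w. (u w)\<^sup>2 / 2 + e_field K cv \<gamma> \<tau> S w) w
          + d_x (\<lambda>w. u w * p_field K cv \<gamma> \<tau> S w) w = 0)"

section \<open>Derivatives along characteristics and the gradient variables\<close>

definition d_forward :: "(real \<times> real \<Rightarrow> real) \<Rightarrow> (real \<times> real \<Rightarrow> real) \<Rightarrow> real \<times> real \<Rightarrow> real" where
  "d_forward c f = (\<lambda>w. d_t f w + c w * d_x f w)"

definition d_backward :: "(real \<times> real \<Rightarrow> real) \<Rightarrow> (real \<times> real \<Rightarrow> real) \<Rightarrow> real \<times> real \<Rightarrow> real" where
  "d_backward c f = (\<lambda>w. d_t f w - c w * d_x f w)"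

text \<open>The expressions of \<open>\<alpha>\<close> and \<open>\<beta>\<close> through \<open>u\<^sub>x\<close>, \<open>z\<^sub>x\<close>, \<open>m\<^sub>x\<close>, valid for smooth solutions,
  are the lemmas \<open>alpha_eq\<close> and \<open>beta_eq\<close> below.\<close>

definition alpha :: "real \<Rightarrow> real \<Rightarrow> real \<Rightarrow> (real \<times> real \<Rightarrow> real) \<Rightarrow> (real \<times> real \<Rightarrow> real)
    \<Rightarrow> real \<times> real \<Rightarrow> real" where
  "alpha K cv \<gamma> \<tau> S = (\<lambda>w. - d_backward (c_field K cv \<gamma> \<tau> S) (p_field K cv \<gamma> \<tau> S) w
     / (c_field K cv \<gamma> \<tau> S w)\<^sup>2)"

definition beta :: "real \<Rightarrow> real \<Rightarrow> real \<Rightarrow> (real \<times> real \<Rightarrow> real) \<Rightarrow> (real \<times> real \<Rightarrow> real)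
    \<Rightarrow> real \<times> real \<Rightarrow> real" where
  "beta K cv \<gamma> \<tau> S = (\<lambda>w. - d_forward (c_field K cv \<gamma> \<tau> S) (p_field K cv \<gamma> \<tau> S) w
     / (c_field K cv \<gamma> \<tau> S w)\<^sup>2)"

definition k1 :: "real \<Rightarrow> real \<Rightarrow> (real \<times> real \<Rightarrow> real) \<Rightarrow> real \<times> real \<Rightarrow> real" where
  "k1 K \<gamma> \<tau> = (\<lambda>w. (\<gamma> + 1) * K_c K \<gamma> / (2 * (\<gamma> - 1)) * z_field K \<gamma> \<tau> w powr (2 / (\<gamma> - 1)))"

definition k2 :: "real \<Rightarrow> real \<Rightarrow> real \<Rightarrow> (real \<times> real \<Rightarrow> real) \<Rightarrow> (real \<times> real \<Rightarrow> real)
    \<Rightarrow> real \<times> real \<Rightarrow> real" where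
  "k2 K cv \<gamma> \<tau> S = (\<lambda>w. (\<gamma> - 1) / (\<gamma> * (\<gamma> + 1)) * z_field K \<gamma> \<tau> w * d_x (m_field cv S) w)"

section \<open>Agreement of the equivalent expressions for the wave speed, alpha and beta\<close>

lemma pressure_deriv_tau:
  assumes "v > 0"
  shows "((\<lambda>v. pressure K cv \<gamma> v S) has_real_derivative - \<gamma> * pressure K cv \<gamma> v S / v) (at v)"
proof -
  have "v powr (- \<gamma> - 1) = v powr (- \<gamma>) / v"
    using assms by (simp add: powr_diff)
  then show ?thesis
    unfolding pressure_def using assms
    by (auto intro!: derivative_eq_intros)
qed

lemma wave_speed_square:
  assumes "K > 0" "\<gamma> > 1" "v > 0"
  shows "(wave_speed K cv \<gamma> v S)\<^sup>2 = \<gamma> * pressure K cv \<gamma> v S / v" "wave_speed K cv \<gamma> v S > 0"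
proof -
  have d: "deriv (\<lambda>v. pressure K cv \<gamma> v S) v = - \<gamma> * pressure K cv \<gamma> v S / v"
    using pressure_deriv_tau[OF assms(3)] by (rule DERIV_imp_deriv)
  have "\<gamma> * pressure K cv \<gamma> v S / v > 0"
    using assms by (simp add: pressure_def)
  then show "(wave_speed K cv \<gamma> v S)\<^sup>2 = \<gamma> * pressure K cv \<gamma> v S / v" "wave_speed K cv \<gamma> v S > 0"
    by (simp_all add: wave_speed_def d)
qed

lemma wave_speed_tau:
  assumes "K > 0" "\<gamma> > 1" "v > 0"
  shows "wave_speed K cv \<gamma> v S = sqrt (K * \<gamma>) * exp (S / (2 * cv)) * v powr (- ((\<gamma> + 1) / 2))"
proof -
  have a: "(exp (S / (2 * cv)))\<^sup>2 = exp (S / cv)"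
    by (simp flip: exp_double)
  have "(v powr (- ((\<gamma> + 1) / 2)))\<^sup>2 = v powr (- \<gamma> - 1)"
    unfolding power2_eq_square powr_add[symmetric]
    by (rule arg_cong[where f = "(powr) v"]) (simp add: field_simps)
  also have "\<dots> = v powr (- \<gamma>) / v"
    using assms by (simp add: powr_diff)
  finally have b: "(v powr (- ((\<gamma> + 1) / 2)))\<^sup>2 = v powr (- \<gamma>) / v" .
  have "(wave_speed K cv \<gamma> v S)\<^sup>2
      = (sqrt (K * \<gamma>) * exp (S / (2 * cv)) * v powr (- ((\<gamma> + 1) / 2)))\<^sup>2"
    unfolding power_mult_distrib a b wave_speed_square(1)[OF assms]
    using assms by (simp add: pressure_def)
  then show ?thesis
    using wave_speed_square(2)[OF assms] assms
    by (subst (asm) power2_eq_iff_nonneg) (auto simp: less_imp_le)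
qed

lemma wave_speed_eq:
  assumes "K > 0" "\<gamma> > 1" "\<tau> w > 0"
  shows "c_field K cv \<gamma> \<tau> S w
    = K_c K \<gamma> * m_field cv S w * z_field K \<gamma> \<tau> w powr ((\<gamma> + 1) / (\<gamma> - 1))"
proof -
  define A where "A = 2 * sqrt (K * \<gamma>) / (\<gamma> - 1)"
  have A: "A > 0" using assms by (simp add: A_def)
  have e: "(2 / (\<gamma> - 1)) * (- ((\<gamma> + 1) / 2)) = - ((\<gamma> + 1) / (\<gamma> - 1))"
    "(- ((\<gamma> - 1) / 2)) * ((\<gamma> + 1) / (\<gamma> - 1)) = - ((\<gamma> + 1) / 2)"
    using assms by (simp_all add: divide_simps) (simp_all add: algebra_simps)
  have "(A * \<tau> w powr (- ((\<gamma> - 1) / 2))) powr ((\<gamma> + 1) / (\<gamma> - 1))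
      = A powr ((\<gamma> + 1) / (\<gamma> - 1)) * \<tau> w powr (- ((\<gamma> + 1) / 2))"
    using A by (simp only: powr_mult powr_powr e)
  moreover have "(A powr (2 / (\<gamma> - 1))) powr (- ((\<gamma> + 1) / 2)) * A powr ((\<gamma> + 1) / (\<gamma> - 1)) = 1"
    using A by (simp only: powr_powr e flip: powr_add) simp
  ultimately show ?thesis
    using assms unfolding c_field_def wave_speed_tau[OF assms] K_c_def K_tau_def
      z_field_def m_field_def A_def[symmetric]
    by (simp add: mult_ac)
qed

lemma C1_onD:
  assumes "C1_on \<Omega> f" "(t, x) \<in> \<Omega>"
  shows "((\<lambda>s. f (s, x)) has_real_derivative d_t f (t, x)) (at t)"
    and "((\<lambda>y. f (t, y)) has_real_derivative d_x f (t, x)) (at x)"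
  using assms by (auto simp: C1_on_def d_t_def d_x_def DERIV_deriv_iff_real_differentiable)

lemma pressure_deriv:
  assumes f: "(f has_real_derivative f') (at r)" and g: "(g has_real_derivative g') (at r)"
    and "f r > 0"
  shows "((\<lambda>s. pressure K cv \<gamma> (f s) (g s)) has_real_derivative
    pressure K cv \<gamma> (f r) (g r) * (g' / cv - \<gamma> * f' / f r)) (at r)"
proof -
  have d: "((\<lambda>s. f s powr (- \<gamma>)) has_real_derivative - \<gamma> * f r powr (- \<gamma> - 1) * f') (at r)"
    using has_real_derivative_powr[OF assms(3)] f by (rule DERIV_chain2)
  have e: "((\<lambda>s. exp (g s / cv)) has_real_derivative exp (g r / cv) * (g' / cv)) (at r)"
    by (rule DERIV_chain2[OF DERIV_exp DERIV_cdivide[OF g]])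
  have h: "f r powr (- \<gamma> - 1) = f r powr (- \<gamma>) / f r"
    using assms(3) by (simp add: powr_diff)
  show ?thesis
    using DERIV_mult[OF DERIV_cmult[OF e, of K] d] unfolding pressure_def h
    by (rule DERIV_cong) (simp add: algebra_simps)
qed

lemma internal_energy_deriv:
  assumes f: "(f has_real_derivative f') (at r)" and g: "(g has_real_derivative g') (at r)"
    and "f r > 0"
  shows "((\<lambda>s. internal_energy K cv \<gamma> (f s) (g s)) has_real_derivative
    pressure K cv \<gamma> (f r) (g r) * (f r * g' / cv + (1 - \<gamma>) * f') / (\<gamma> - 1)) (at r)"
  unfolding internal_energy_def
  by (rule DERIV_cong[OF DERIV_cdivide[OF DERIV_mult[OF pressure_deriv[OF assms] f]]],
      rule arg_cong[where f = "\<lambda>a. a / (\<gamma> - 1)"])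
    (use assms(3) in \<open>simp add: algebra_simps\<close>)

lemma smooth_solution_entropy:
  assumes K: "K > 0" and cv: "cv > 0" and \<gamma>: "\<gamma> > 1"
    and sol: "smooth_euler_solution K cv \<gamma> \<Omega> \<tau> u S" and "w \<in> \<Omega>"
  shows "d_t S w = 0"
proof -
  obtain t x where w: "w = (t, x)" by (cases w)
  have C: "C1_on \<Omega> \<tau>" "C1_on \<Omega> u" "C1_on \<Omega> S" and \<tau>: "\<tau> w > 0"
    and e1: "d_t \<tau> w = d_x u w"
    and e2: "d_t u w + d_x (p_field K cv \<gamma> \<tau> S) w = 0"
    and e3: "d_t (\<lambda>w. (u w)\<^sup>2 / 2 + e_field K cv \<gamma> \<tau> S w) w
          + d_x (\<lambda>w. u w * p_field K cv \<gamma> \<tau> S w) w = 0"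
    using sol \<open>w \<in> \<Omega>\<close> by (auto simp: smooth_euler_solution_def C2_on_def)
  have dt: "((\<lambda>s. f (s, x)) has_real_derivative d_t f w) (at t)"
    and dx: "((\<lambda>y. f (t, y)) has_real_derivative d_x f w) (at x)" if "C1_on \<Omega> f" for f
    using C1_onD[OF that] \<open>w \<in> \<Omega>\<close> by (auto simp: w)
  let ?p = "pressure K cv \<gamma> (\<tau> w) (S w)"
  have px: "((\<lambda>y. p_field K cv \<gamma> \<tau> S (t, y)) has_real_derivative
      d_x (p_field K cv \<gamma> \<tau> S) w) (at x)"
  proof -
    have "((\<lambda>y. p_field K cv \<gamma> \<tau> S (t, y)) has_real_derivative
        ?p * (d_x S w / cv - \<gamma> * d_x \<tau> w / \<tau> w)) (at x)"
      using pressure_deriv[OF dx[OF C(1)] dx[OF C(3)]] \<tau> by (simp add: w p_field_def)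
    moreover from DERIV_imp_deriv[OF this]
    have "d_x (p_field K cv \<gamma> \<tau> S) w = ?p * (d_x S w / cv - \<gamma> * d_x \<tau> w / \<tau> w)"
      by (simp add: w d_x_def[of "p_field K cv \<gamma> \<tau> S"])
    ultimately show ?thesis by simp
  qed
  have et: "((\<lambda>s. e_field K cv \<gamma> \<tau> S (s, x)) has_real_derivative
      ?p * (\<tau> w * d_t S w / cv + (1 - \<gamma>) * d_t \<tau> w) / (\<gamma> - 1)) (at t)"
    using internal_energy_deriv[OF dt[OF C(1)] dt[OF C(3)]] \<tau>
    by (simp add: w e_field_def)
  have "((\<lambda>s. (u (s, x))\<^sup>2 / 2 + e_field K cv \<gamma> \<tau> S (s, x)) has_real_derivative
      u w * d_t u w + ?p * (\<tau> w * d_t S w / cv + (1 - \<gamma>) * d_t \<tau> w) / (\<gamma> - 1)) (at t)"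
    by (auto intro!: derivative_eq_intros et dt[OF C(2)] simp: w)
  then have t: "d_t (\<lambda>w. (u w)\<^sup>2 / 2 + e_field K cv \<gamma> \<tau> S w) w
      = u w * d_t u w + ?p * (\<tau> w * d_t S w / cv + (1 - \<gamma>) * d_t \<tau> w) / (\<gamma> - 1)"
    by (simp add: d_t_def w DERIV_imp_deriv)
  have "((\<lambda>y. u (t, y) * p_field K cv \<gamma> \<tau> S (t, y)) has_real_derivative
      d_x u w * ?p + u w * d_x (p_field K cv \<gamma> \<tau> S) w) (at x)"
    using DERIV_mult[OF dx[OF C(2)] px]
    by (rule DERIV_cong) (simp add: w p_field_def[of K cv \<gamma> \<tau> S, THEN fun_cong, of "(t, x)"])
  then have x: "d_x (\<lambda>w. u w * p_field K cv \<gamma> \<tau> S w) w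
      = d_x u w * ?p + u w * d_x (p_field K cv \<gamma> \<tau> S) w"
    by (simp add: d_x_def w DERIV_imp_deriv)
  have ut: "d_t u w = - d_x (p_field K cv \<gamma> \<tau> S) w" using e2 by simp
  have "?p * (\<tau> w * d_t S w / cv) / (\<gamma> - 1) = 0"
    using e3 \<gamma> unfolding t x e1 ut by (simp add: field_simps)
  moreover have "?p > 0" using K \<tau> by (simp add: pressure_def)
  ultimately show ?thesis using \<tau> cv \<gamma> by simp
qed

lemma
  assumes K: "K > 0" and cv: "cv > 0" and \<gamma>: "\<gamma> > 1"
    and sol: "smooth_euler_solution K cv \<gamma> \<Omega> \<tau> u S" and "w \<in> \<Omega>"
  shows alpha_eq: "alpha K cv \<gamma> \<tau> S w = d_x u w + m_field cv S w * d_x (z_field K \<gamma> \<tau>) w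
      + (\<gamma> - 1) / \<gamma> * d_x (m_field cv S) w * z_field K \<gamma> \<tau> w"
    and beta_eq: "beta K cv \<gamma> \<tau> S w = d_x u w - m_field cv S w * d_x (z_field K \<gamma> \<tau>) w
      - (\<gamma> - 1) / \<gamma> * d_x (m_field cv S) w * z_field K \<gamma> \<tau> w"
proof -
  obtain t x where w: "w = (t, x)" by (cases w)
  have C: "C1_on \<Omega> \<tau>" "C1_on \<Omega> S" and \<tau>: "\<tau> w > 0" and e1: "d_t \<tau> w = d_x u w"
    using sol \<open>w \<in> \<Omega>\<close> by (auto simp: smooth_euler_solution_def C2_on_def)
  have dt: "((\<lambda>s. f (s, x)) has_real_derivative d_t f w) (at t)"
    and dx: "((\<lambda>y. f (t, y)) has_real_derivative d_x f w) (at x)" if "C1_on \<Omega> f" for f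
    using C1_onD[OF that] \<open>w \<in> \<Omega>\<close> by (auto simp: w)
  define p where "p = pressure K cv \<gamma> (\<tau> w) (S w)"
  define c where "c = c_field K cv \<gamma> \<tau> S w"
  have c: "c > 0" "c\<^sup>2 = \<gamma> * p / \<tau> w"
    using wave_speed_square[OF K \<gamma> \<tau>] by (simp_all add: c_def p_def c_field_def)
  have p: "p = c\<^sup>2 * \<tau> w / \<gamma>" using c(2) \<tau> \<gamma> by simp
  have pt: "d_t (p_field K cv \<gamma> \<tau> S) w = - c\<^sup>2 * d_x u w"
    using DERIV_imp_deriv[OF pressure_deriv[OF dt[OF C(1)] dt[OF C(2)]]] \<tau>
      smooth_solution_entropy[OF assms]
    by (simp add: w d_t_def[of "\<lambda>w. pressure K cv \<gamma> (\<tau> w) (S w)"] p_field_def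
        e1[unfolded w] c(2)[unfolded w] p_def)
  have px: "d_x (p_field K cv \<gamma> \<tau> S) w = p * (d_x S w / cv - \<gamma> * d_x \<tau> w / \<tau> w)"
    using DERIV_imp_deriv[OF pressure_deriv[OF dx[OF C(1)] dx[OF C(2)]]] \<tau>
    by (simp add: w d_x_def[of "\<lambda>w. pressure K cv \<gamma> (\<tau> w) (S w)"] p_field_def p_def)
  have "((\<lambda>y. m_field cv S (t, y)) has_real_derivative m_field cv S w * d_x S w / (2 * cv)) (at x)"
    unfolding m_field_def using cv by (auto intro!: derivative_eq_intros dx[OF C(2)] simp: w)
  then have mx: "d_x (m_field cv S) w = m_field cv S w * d_x S w / (2 * cv)"
    by (simp add: w d_x_def[of "m_field cv S"] DERIV_imp_deriv)
  define q where "q = - ((\<gamma> - 1) / 2)"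
  have "((\<lambda>y. \<tau> (t, y) powr q) has_real_derivative q * \<tau> (t, x) powr (q - 1) * d_x \<tau> w) (at x)"
    using has_real_derivative_powr[OF \<tau>] dx[OF C(1)] unfolding w by (rule DERIV_chain2)
  from DERIV_cmult[OF this, of "2 * sqrt (K * \<gamma>) / (\<gamma> - 1)"]
  have "((\<lambda>y. z_field K \<gamma> \<tau> (t, y)) has_real_derivative
      q * z_field K \<gamma> \<tau> w * d_x \<tau> w / \<tau> w) (at x)"
    using \<tau> by (simp add: z_field_def q_def[symmetric] w powr_diff mult.assoc mult.left_commute)
  then have zx: "d_x (z_field K \<gamma> \<tau>) w = q * z_field K \<gamma> \<tau> w * d_x \<tau> w / \<tau> w"
    by (simp add: w d_x_def[of "z_field K \<gamma> \<tau>"] DERIV_imp_deriv)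
  have "\<tau> w powr q = \<tau> w powr (- ((\<gamma> + 1) / 2) + 1)"
    by (rule arg_cong[where f = "(powr) (\<tau> w)"]) (simp add: q_def field_simps)
  then have "\<tau> w powr q = \<tau> w powr (- ((\<gamma> + 1) / 2)) * \<tau> w"
    using \<tau> by (simp only: powr_add) simp
  then have mz: "m_field cv S w * z_field K \<gamma> \<tau> w = 2 / (\<gamma> - 1) * c * \<tau> w"
    unfolding c_def c_field_def wave_speed_tau[OF K \<gamma> \<tau>] m_field_def z_field_def q_def[symmetric]
    by simp
  have a: "m_field cv S w * d_x (z_field K \<gamma> \<tau>) w = - c * d_x \<tau> w"
  proof -
    have "m_field cv S w * d_x (z_field K \<gamma> \<tau>) w
        = q * (m_field cv S w * z_field K \<gamma> \<tau> w) * d_x \<tau> w / \<tau> w"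
      unfolding zx by simp
    then show ?thesis unfolding mz q_def using \<tau> \<gamma> by simp
  qed
  have b: "(\<gamma> - 1) / \<gamma> * d_x (m_field cv S) w * z_field K \<gamma> \<tau> w = c * \<tau> w * d_x S w / (\<gamma> * cv)"
  proof -
    have "(\<gamma> - 1) / \<gamma> * d_x (m_field cv S) w * z_field K \<gamma> \<tau> w
        = (\<gamma> - 1) / \<gamma> * (m_field cv S w * z_field K \<gamma> \<tau> w) * d_x S w / (2 * cv)"
      unfolding mx by simp
    then show ?thesis unfolding mz using \<gamma> cv by simp
  qed
  have pxc: "d_x (p_field K cv \<gamma> \<tau> S) w / c = c * \<tau> w * d_x S w / (\<gamma> * cv) - c * d_x \<tau> w"
    unfolding px p using c(1) \<tau> \<gamma> cv by (simp add: field_simps power2_eq_square)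
  have "alpha K cv \<gamma> \<tau> S w = d_x u w + d_x (p_field K cv \<gamma> \<tau> S) w / c"
    unfolding alpha_def d_backward_def c_def[symmetric] pt
    using c(1) by (simp add: field_simps power2_eq_square)
  then show "alpha K cv \<gamma> \<tau> S w = d_x u w + m_field cv S w * d_x (z_field K \<gamma> \<tau>) w
      + (\<gamma> - 1) / \<gamma> * d_x (m_field cv S) w * z_field K \<gamma> \<tau> w"
    unfolding a b pxc by simp
  have "beta K cv \<gamma> \<tau> S w = d_x u w - d_x (p_field K cv \<gamma> \<tau> S) w / c"
    unfolding beta_def d_forward_def c_def[symmetric] pt
    using c(1) by (simp add: field_simps power2_eq_square)
  then show "beta K cv \<gamma> \<tau> S w = d_x u w - m_field cv S w * d_x (z_field K \<gamma> \<tau>) w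
      - (\<gamma> - 1) / \<gamma> * d_x (m_field cv S) w * z_field K \<gamma> \<tau> w"
    unfolding a b pxc by simp
qed

end

theory Submission
  imports Defs
begin

text \<open>
  The whole computation is carried out in the primitive fields \<open>u\<close>, \<open>\<tau>\<close>, \<open>S\<close> rather than in
  \<open>z\<close> and \<open>m\<close>.  Put \<open>g = p\<^sub>x / c\<close>.  Along a smooth solution the entropy is constant in time, so
  \<open>p\<^sub>t = p\<^sub>\<tau> \<tau>\<^sub>t = - c\<^sup>2 u\<^sub>x\<close>, and the gradient variables become \<open>\<alpha> = u\<^sub>x + g\<close> and
  \<open>\<beta> = u\<^sub>x - g\<close> (lemmas \<open>alpha_via_g\<close> and \<open>beta_via_g\<close>).

  Differentiating the momentum equation \<open>u\<^sub>t = - c g\<close> in \<open>x\<close> and the formula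
  \<open>g = c (\<tau> S\<^sub>x / (\<gamma> cv) - \<tau>\<^sub>x)\<close> in \<open>t\<close>, and interchanging the mixed second derivatives, gives
    \<open>u\<^sub>x\<^sub>t = - c\<^sub>x g - c g\<^sub>x\<close>  and  \<open>g\<^sub>t = c\<^sub>t g / c + c u\<^sub>x S\<^sub>x / (\<gamma> cv) - c u\<^sub>x\<^sub>x\<close>
  (lemmas \<open>d_t_d_x_u\<close> and \<open>d_t_g\<close>).  These form a symmetric system for \<open>(u\<^sub>x, g)\<close> whose
  principal part is diagonalised by \<open>u\<^sub>x \<plusminus> g\<close> with speeds \<open>\<plusminus> c\<close>: in the characteristic
  derivatives of \<open>\<alpha>\<close> and \<open>\<beta>\<close> all second derivatives cancel.  For \<open>\<alpha>\<close> this leaves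
    \<open>\<alpha>' = - c\<^sub>x g + c\<^sub>t g / c + c u\<^sub>x S\<^sub>x / (\<gamma> cv)\<close>.
  As \<open>c\<close> is an explicit function of \<open>\<tau>\<close> and \<open>S\<close>, its derivatives are combinations of \<open>u\<^sub>x\<close>,
  \<open>g\<close> and \<open>S\<^sub>x\<close>, and the right-hand side becomes the stated quadratic expression once the
  coefficients are recognised as \<open>k1 = (\<gamma> + 1) / (4 \<tau>)\<close> and
  \<open>k1 k2 = c S\<^sub>x / (4 \<gamma> cv)\<close> (lemmas \<open>k1_via_tau\<close>, \<open>k1_k2\<close> and \<open>riccati\<close>).

  The analytic content is the symmetry of the mixed derivatives (\<open>mixed_partials_commute\<close>) and
  the calculus of functions with continuous partial derivatives, which also yields that \<open>\<alpha>\<close>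
  and \<open>\<beta>\<close> are continuously differentiable.
\<close>

section \<open>Calculus of $C^1$ functions in the plane\<close>

lemma eventually_slices_mem:
  assumes "open \<Omega>" "(t, x) \<in> \<Omega>"
  shows "\<forall>\<^sub>F s in nhds t. (s, x) \<in> \<Omega>" and "\<forall>\<^sub>F y in nhds x. (t, y) \<in> \<Omega>"
proof -
  obtain A B where AB: "open A" "open B" "t \<in> A" "x \<in> B" "A \<times> B \<subseteq> \<Omega>"
    by (rule open_prod_elim[OF assms]) auto
  then show "\<forall>\<^sub>F s in nhds t. (s, x) \<in> \<Omega>" and "\<forall>\<^sub>F y in nhds x. (t, y) \<in> \<Omega>"
    unfolding eventually_nhds by blast+
qed

lemma partial_derivatives_cong:
  assumes "open \<Omega>" "\<And>w. w \<in> \<Omega> \<Longrightarrow> f w = g w" "w \<in> \<Omega>"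
  shows d_t_cong: "d_t f w = d_t g w" and d_x_cong: "d_x f w = d_x g w"
proof -
  obtain t x where w: "w = (t, x)" by (cases w)
  note ev = eventually_slices_mem[OF assms(1) assms(3)[unfolded w]]
  have "\<forall>\<^sub>F s in nhds t. f (s, x) = g (s, x)" "\<forall>\<^sub>F y in nhds x. f (t, y) = g (t, y)"
    by (rule eventually_mono[OF ev(1)] eventually_mono[OF ev(2)], simp add: assms(2))+
  from this[THEN deriv_cong_ev[OF _ refl]] show "d_t f w = d_t g w" "d_x f w = d_x g w"
    by (simp_all add: w d_t_def d_x_def)
qed

lemma C1_onI:
  assumes "\<And>t x. (t, x) \<in> \<Omega> \<Longrightarrow> ((\<lambda>s. f (s, x)) has_real_derivative ft (t, x)) (at t)"
    and "\<And>t x. (t, x) \<in> \<Omega> \<Longrightarrow> ((\<lambda>y. f (t, y)) has_real_derivative fx (t, x)) (at x)"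
    and "continuous_on \<Omega> ft" "continuous_on \<Omega> fx"
  shows "C1_on \<Omega> f" and "w \<in> \<Omega> \<Longrightarrow> d_t f w = ft w" and "w \<in> \<Omega> \<Longrightarrow> d_x f w = fx w"
proof -
  have t: "d_t f w = ft w" and x: "d_x f w = fx w" if "w \<in> \<Omega>" for w
    using that assms(1,2)[of "fst w" "snd w"]
    by (auto simp: d_t_def d_x_def split_beta DERIV_imp_deriv)
  show "w \<in> \<Omega> \<Longrightarrow> d_t f w = ft w" and "w \<in> \<Omega> \<Longrightarrow> d_x f w = fx w"
    by (rule t x; assumption)+
  have "continuous_on \<Omega> (d_t f)" "continuous_on \<Omega> (d_x f)"
    using assms(3,4) t x by (simp_all cong: continuous_on_cong)
  then show "C1_on \<Omega> f"
    using assms(1,2) unfolding C1_on_def real_differentiable_def by blast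
qed

lemma C1_on_cong:
  assumes "open \<Omega>" "\<And>w. w \<in> \<Omega> \<Longrightarrow> f w = g w" "C1_on \<Omega> g"
  shows "C1_on \<Omega> f"
proof (rule C1_onI(1))
  fix t x assume w: "(t, x) \<in> \<Omega>"
  note ev = eventually_slices_mem[OF assms(1) w]
  have eq: "\<forall>\<^sub>F s in nhds t. f (s, x) = g (s, x)" "\<forall>\<^sub>F y in nhds x. f (t, y) = g (t, y)"
    by (rule eventually_mono[OF ev(1)] eventually_mono[OF ev(2)], simp add: assms(2))+
  show "((\<lambda>s. f (s, x)) has_real_derivative d_t g (t, x)) (at t)"
    by (rule iffD2[OF DERIV_cong_ev[OF refl eq(1) refl] C1_onD(1)[OF assms(3) w]])
  show "((\<lambda>y. f (t, y)) has_real_derivative d_x g (t, x)) (at x)"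
    by (rule iffD2[OF DERIV_cong_ev[OF refl eq(2) refl] C1_onD(2)[OF assms(3) w]])
next
  show "continuous_on \<Omega> (d_t g)" "continuous_on \<Omega> (d_x g)"
    using assms(3) by (simp_all add: C1_on_def)
qed

text \<open>The coordinate derivatives of a function say nothing about its joint continuity; it is the
  continuity of the partial derivatives that makes the function totally differentiable, hence
  continuous.  The product and chain rules below need this, since the function itself
  occurs in the partial derivatives of products and composites.\<close>

lemma C1_on_imp_continuous_on:
  assumes "open \<Omega>" "C1_on \<Omega> f"
  shows "continuous_on \<Omega> f"
proof (rule continuous_at_imp_continuous_on, safe)
  fix t x assume w: "(t, x) \<in> \<Omega>"
  obtain A B where A: "open A" "t \<in> A" and B: "open B" "x \<in> B" and AB: "A \<times> B \<subseteq> \<Omega>"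
    by (rule open_prod_elim[OF assms(1) w]) auto
  \<comment> \<open>The total derivative is built on a product whose second factor is convex.\<close>
  obtain e where e: "e > 0" "ball x e \<subseteq> B" using B by (meson openE)
  define Y where "Y = ball x e"
  have Y: "open Y" "x \<in> Y" "convex Y" and AY: "A \<times> Y \<subseteq> \<Omega>"
    using e AB by (auto simp: Y_def)
  have op: "open (A \<times> Y)" using A Y by (simp add: open_Times)
  have m: "(t, x) \<in> A \<times> Y" using A Y by simp
  define D where "D = (\<lambda>s y. blinfun_scaleR_left (d_x f (s, y)) :: real \<Rightarrow>\<^sub>L real)"
  have c: "continuous_on (A \<times> Y) (d_x f)"
    using assms(2) AY by (auto simp: C1_on_def intro: continuous_on_subset)
  have "continuous (at (t, x) within A \<times> Y) (\<lambda>(s, y). D s y)"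
  proof -
    have "continuous (at (t, x) within A \<times> Y) (\<lambda>w. blinfun_scaleR_left (d_x f w) :: real \<Rightarrow>\<^sub>L real)"
      using c m by (intro bounded_linear.continuous[OF bounded_linear_blinfun_scaleR_left])
        (auto simp: continuous_on_eq_continuous_within)
    moreover have "(\<lambda>(s, y). D s y) = (\<lambda>w. blinfun_scaleR_left (d_x f w))"
      by (auto simp: D_def fun_eq_iff)
    ultimately show ?thesis by simp
  qed
  moreover have "((\<lambda>s. f (s, x)) has_derivative (*) (d_t f (t, x))) (at t within A)"
    using C1_onD(1)[OF assms(2) w]
    by (auto simp: has_field_derivative_def intro: has_derivative_at_withinI)
  moreover have "((\<lambda>y. f (s, y)) has_derivative blinfun_apply (D s y)) (at y within Y)"
    if "s \<in> A" "y \<in> Y" for s y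
  proof -
    have "blinfun_apply (D s y) = (*) (d_x f (s, y))" by (simp add: D_def fun_eq_iff)
    then show ?thesis
      using C1_onD(2)[OF assms(2), of s y] that AY
      by (auto simp: has_field_derivative_def intro: has_derivative_at_withinI)
  qed
  ultimately have "((\<lambda>(s, y). f (s, y)) has_derivative
      (\<lambda>(h, k). d_t f (t, x) * h + blinfun_apply (D t x) k)) (at (t, x) within A \<times> Y)"
    using Y by (intro has_derivative_partialsI) auto
  from has_derivative_continuous[OF this] show "isCont f (t, x)"
    using at_within_open[OF m op] by simp
qed

lemma C1_on_const: "C1_on \<Omega> (\<lambda>_. k)"
  and d_t_const: "d_t (\<lambda>_. k) = (\<lambda>_. 0)" and d_x_const: "d_x (\<lambda>_. k) = (\<lambda>_. 0)"
  by (auto simp: C1_on_def d_t_def d_x_def)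

lemma
  assumes "open \<Omega>" "C1_on \<Omega> f" "C1_on \<Omega> g"
  shows C1_on_add: "C1_on \<Omega> (\<lambda>w. f w + g w)"
    and d_t_add: "w \<in> \<Omega> \<Longrightarrow> d_t (\<lambda>w. f w + g w) w = d_t f w + d_t g w"
    and d_x_add: "w \<in> \<Omega> \<Longrightarrow> d_x (\<lambda>w. f w + g w) w = d_x f w + d_x g w"
    and C1_on_diff: "C1_on \<Omega> (\<lambda>w. f w - g w)"
    and d_t_diff: "w \<in> \<Omega> \<Longrightarrow> d_t (\<lambda>w. f w - g w) w = d_t f w - d_t g w"
    and d_x_diff: "w \<in> \<Omega> \<Longrightarrow> d_x (\<lambda>w. f w - g w) w = d_x f w - d_x g w"
    and C1_on_mult: "C1_on \<Omega> (\<lambda>w. f w * g w)"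
    and d_t_mult: "w \<in> \<Omega> \<Longrightarrow> d_t (\<lambda>w. f w * g w) w = d_t f w * g w + f w * d_t g w"
    and d_x_mult: "w \<in> \<Omega> \<Longrightarrow> d_x (\<lambda>w. f w * g w) w = d_x f w * g w + f w * d_x g w"
proof -
  note D = C1_onD[OF assms(2)] C1_onD[OF assms(3)]
  have cont: "continuous_on \<Omega> f" "continuous_on \<Omega> g"
    "continuous_on \<Omega> (d_t f)" "continuous_on \<Omega> (d_t g)"
    "continuous_on \<Omega> (d_x f)" "continuous_on \<Omega> (d_x g)"
    using C1_on_imp_continuous_on[OF assms(1,2)] C1_on_imp_continuous_on[OF assms(1,3)] assms(2,3)
    by (simp_all add: C1_on_def)
  note I = C1_onI[of \<Omega> "\<lambda>w. f w + g w" "\<lambda>w. d_t f w + d_t g w" "\<lambda>w. d_x f w + d_x g w"]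
  show "C1_on \<Omega> (\<lambda>w. f w + g w)"
    "w \<in> \<Omega> \<Longrightarrow> d_t (\<lambda>w. f w + g w) w = d_t f w + d_t g w"
    "w \<in> \<Omega> \<Longrightarrow> d_x (\<lambda>w. f w + g w) w = d_x f w + d_x g w"
    by (rule I; (rule DERIV_add D continuous_on_add cont | assumption)+)+
  note I = C1_onI[of \<Omega> "\<lambda>w. f w - g w" "\<lambda>w. d_t f w - d_t g w" "\<lambda>w. d_x f w - d_x g w"]
  show "C1_on \<Omega> (\<lambda>w. f w - g w)"
    "w \<in> \<Omega> \<Longrightarrow> d_t (\<lambda>w. f w - g w) w = d_t f w - d_t g w"
    "w \<in> \<Omega> \<Longrightarrow> d_x (\<lambda>w. f w - g w) w = d_x f w - d_x g w"
    by (rule I; (rule DERIV_diff D continuous_on_diff cont | assumption)+)+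
  have D2: "((\<lambda>s. f (s, x) * g (s, x)) has_real_derivative
        d_t f (t, x) * g (t, x) + f (t, x) * d_t g (t, x)) (at t)"
    "((\<lambda>y. f (t, y) * g (t, y)) has_real_derivative
        d_x f (t, x) * g (t, x) + f (t, x) * d_x g (t, x)) (at x)"
    if w: "(t, x) \<in> \<Omega>" for t x
    using DERIV_mult[OF D(1)[OF w] D(3)[OF w]] DERIV_mult[OF D(2)[OF w] D(4)[OF w]]
    by (simp_all add: mult.commute)
  note I = C1_onI[of \<Omega> "\<lambda>w. f w * g w" "\<lambda>w. d_t f w * g w + f w * d_t g w"
      "\<lambda>w. d_x f w * g w + f w * d_x g w"]
  show "C1_on \<Omega> (\<lambda>w. f w * g w)"
    "w \<in> \<Omega> \<Longrightarrow> d_t (\<lambda>w. f w * g w) w = d_t f w * g w + f w * d_t g w"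
    "w \<in> \<Omega> \<Longrightarrow> d_x (\<lambda>w. f w * g w) w = d_x f w * g w + f w * d_x g w"
    by (rule I; (rule D2 continuous_on_add continuous_on_mult cont | assumption)+)+
qed

lemma
  assumes "open \<Omega>" "C1_on \<Omega> f"
    and h: "\<And>w. w \<in> \<Omega> \<Longrightarrow> (h has_real_derivative h' (f w)) (at (f w))"
    and h': "continuous_on (f ` \<Omega>) h'"
  shows C1_on_compose: "C1_on \<Omega> (\<lambda>w. h (f w))"
    and d_t_compose: "w \<in> \<Omega> \<Longrightarrow> d_t (\<lambda>w. h (f w)) w = h' (f w) * d_t f w"
    and d_x_compose: "w \<in> \<Omega> \<Longrightarrow> d_x (\<lambda>w. h (f w)) w = h' (f w) * d_x f w"
proof -
  have cont: "continuous_on \<Omega> (\<lambda>w. h' (f w))"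
    "continuous_on \<Omega> (d_t f)" "continuous_on \<Omega> (d_x f)"
    using continuous_on_compose2[OF h' C1_on_imp_continuous_on[OF assms(1,2)]] assms(2)
    by (simp_all add: C1_on_def)
  have D: "((\<lambda>s. h (f (s, x))) has_real_derivative h' (f (t, x)) * d_t f (t, x)) (at t)"
    "((\<lambda>y. h (f (t, y))) has_real_derivative h' (f (t, x)) * d_x f (t, x)) (at x)"
    if w: "(t, x) \<in> \<Omega>" for t x
    using DERIV_chain2[OF h[OF w] C1_onD(1)[OF assms(2) w]]
      DERIV_chain2[OF h[OF w] C1_onD(2)[OF assms(2) w]] by simp_all
  note I = C1_onI[of \<Omega> "\<lambda>w. h (f w)" "\<lambda>w. h' (f w) * d_t f w" "\<lambda>w. h' (f w) * d_x f w"]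
  show "C1_on \<Omega> (\<lambda>w. h (f w))"
    "w \<in> \<Omega> \<Longrightarrow> d_t (\<lambda>w. h (f w)) w = h' (f w) * d_t f w"
    "w \<in> \<Omega> \<Longrightarrow> d_x (\<lambda>w. h (f w)) w = h' (f w) * d_x f w"
    by (rule I; (rule D continuous_on_mult cont | assumption)+)+
qed

section \<open>Symmetry of the mixed second derivatives\<close>

text \<open>Read the second difference over a square as the increment over \<open>[t, t + h]\<close> of
  \<open>s \<mapsto> f s (x + h) - f s x\<close>; one mean value step in \<open>s\<close> and one in \<open>y\<close> turn it into
  \<open>h\<^sup>2\<close> times the mixed derivative at some point of the square.\<close>

lemma second_difference_mean_value:
  fixes f fs fsy :: "real \<Rightarrow> real \<Rightarrow> real"
  assumes "h > 0"
    and fs: "\<And>s y. s \<in> {t..t+h} \<Longrightarrow> y \<in> {x..x+h} \<Longrightarrow>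
      ((\<lambda>s. f s y) has_real_derivative fs s y) (at s)"
    and fsy: "\<And>s y. s \<in> {t..t+h} \<Longrightarrow> y \<in> {x..x+h} \<Longrightarrow>
      ((\<lambda>y. fs s y) has_real_derivative fsy s y) (at y)"
  obtains \<xi> \<eta> where "\<xi> \<in> {t..t+h}" "\<eta> \<in> {x..x+h}"
    "f (t+h) (x+h) - f (t+h) x - f t (x+h) + f t x = h * h * fsy \<xi> \<eta>"
proof -
  have "\<exists>\<xi>. t < \<xi> \<and> \<xi> < t + h \<and> (f (t+h) (x+h) - f (t+h) x) - (f t (x+h) - f t x)
      = (t + h - t) * (fs \<xi> (x+h) - fs \<xi> x)"
    using \<open>h > 0\<close> by (intro MVT2 DERIV_diff fs) auto
  then obtain \<xi> where \<xi>: "t < \<xi>" "\<xi> < t + h"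
    "(f (t+h) (x+h) - f (t+h) x) - (f t (x+h) - f t x) = h * (fs \<xi> (x+h) - fs \<xi> x)"
    by auto
  have "\<exists>\<eta>. x < \<eta> \<and> \<eta> < x + h \<and> fs \<xi> (x+h) - fs \<xi> x = (x + h - x) * fsy \<xi> \<eta>"
    using \<open>h > 0\<close> \<xi> by (intro MVT2 fsy) auto
  then obtain \<eta> where "x < \<eta>" "\<eta> < x + h" "fs \<xi> (x+h) - fs \<xi> x = h * fsy \<xi> \<eta>"
    by auto
  with \<xi> that[of \<xi> \<eta>] show ?thesis by (simp add: algebra_simps)
qed

text \<open>The second difference is symmetric in the two variables, so on every small square some value
  of \<open>d_x (d_t f)\<close> equals some value of \<open>d_t (d_x f)\<close>.  If the two mixed derivatives differed
  at \<open>w\<close>, continuity would keep them apart on a whole square at \<open>w\<close>.\<close>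

lemma mixed_partials_commute:
  assumes "open \<Omega>" "C2_on \<Omega> f" "w \<in> \<Omega>"
  shows "d_t (d_x f) w = d_x (d_t f) w"
proof (rule ccontr)
  assume ne: "d_t (d_x f) w \<noteq> d_x (d_t f) w"
  obtain t x where w: "w = (t, x)" by (cases w)
  have C: "C1_on \<Omega> f" "C1_on \<Omega> (d_t f)" "C1_on \<Omega> (d_x f)"
    using assms(2) by (auto simp: C2_on_def)
  define F G where "F = d_t (d_x f)" and "G = d_x (d_t f)"
  have "isCont F w" "isCont G w"
    using assms C unfolding F_def G_def
    by (auto simp: C1_on_def continuous_on_eq_continuous_at)
  \<comment> \<open>Two values, each within half the gap of its limit, cannot meet.\<close>
  define e where "e = \<bar>F w - G w\<bar> / 2"
  have "e > 0" using ne by (simp add: e_def F_def G_def)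
  have "\<forall>\<^sub>F v in nhds w. v \<in> \<Omega> \<and> dist (F v) (F w) < e \<and> dist (G v) (G w) < e"
    using \<open>e > 0\<close> \<open>isCont F w\<close> \<open>isCont G w\<close> assms(1,3)
    by (intro eventually_conj tendstoD) (auto simp: continuous_at tendsto_at_iff_tendsto_nhds
        eventually_nhds)
  then obtain U where U: "open U" "w \<in> U"
    "\<And>v. v \<in> U \<Longrightarrow> v \<in> \<Omega> \<and> dist (F v) (F w) < e \<and> dist (G v) (G w) < e"
    by (auto simp: eventually_nhds)
  obtain A B where AB: "open A" "t \<in> A" "open B" "x \<in> B" "A \<times> B \<subseteq> U"
    by (rule open_prod_elim[OF U(1) U(2)[unfolded w]]) auto
  obtain a b where ab: "a > 0" "cball t a \<subseteq> A" "b > 0" "cball x b \<subseteq> B"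
    using AB unfolding open_contains_cball by meson
  define h where "h = min a b"
  have h: "h > 0" using ab by (simp add: h_def)
  have sq: "(s, y) \<in> U" if "s \<in> {t..t+h}" "y \<in> {x..x+h}" for s y
  proof -
    have "s \<in> cball t a" "y \<in> cball x b" using that by (auto simp: h_def dist_real_def)
    then show ?thesis using ab AB by blast
  qed
  have sq': "(s, y) \<in> \<Omega>" if "s \<in> {t..t+h}" "y \<in> {x..x+h}" for s y
    using sq[OF that] U(3) by blast
  obtain s y where 1: "s \<in> {t..t+h}" "y \<in> {x..x+h}"
    "f (t+h, x+h) - f (t+h, x) - f (t, x+h) + f (t, x) = h * h * G (s, y)"
    using second_difference_mean_value[of h t x "\<lambda>s y. f (s, y)" "\<lambda>s y. d_t f (s, y)"
      "\<lambda>s y. G (s, y)", OF h C1_onD(1)[OF C(1) sq'] C1_onD(2)[OF C(2) sq', folded G_def]]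
    by blast
  obtain y' s' where 2: "y' \<in> {x..x+h}" "s' \<in> {t..t+h}"
    "f (t+h, x+h) - f (t, x+h) - f (t+h, x) + f (t, x) = h * h * F (s', y')"
    using second_difference_mean_value[of h x t "\<lambda>y s. f (s, y)" "\<lambda>y s. d_x f (s, y)"
      "\<lambda>y s. F (s, y)", OF h C1_onD(2)[OF C(1) sq'] C1_onD(1)[OF C(3) sq', folded F_def]]
    by blast
  have "h * h * G (s, y) = h * h * F (s', y')" using 1(3) 2(3) by linarith
  then have "G (s, y) = F (s', y')" using h by simp
  moreover have "dist (G (s, y)) (G w) < e" "dist (F (s', y')) (F w) < e"
    using U(3) sq 1 2 by blast+
  ultimately show False by (simp add: e_def dist_real_def abs_if split: if_splits)
qed

section \<open>Pressure, wave speed and the scaled pressure gradient\<close>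

locale smooth_flow =
  fixes K cv \<gamma> :: real and \<Omega> :: "(real \<times> real) set" and \<tau> u S :: "real \<times> real \<Rightarrow> real"
  assumes K: "K > 0" and cv: "cv > 0" and \<gamma>: "\<gamma> > 1"
    and sol: "smooth_euler_solution K cv \<gamma> \<Omega> \<tau> u S"
begin

abbreviation c where "c \<equiv> c_field K cv \<gamma> \<tau> S"
abbreviation p where "p \<equiv> p_field K cv \<gamma> \<tau> S"

text \<open>This is \<open>p\<^sub>x / c\<close>, written in a form in which only \<open>\<tau>\<close>, \<open>S\<close> and their first derivatives are
  differentiated further; it equals half the difference of \<open>\<alpha>\<close> and \<open>\<beta>\<close>.\<close>

definition g where
  "g = (\<lambda>w. c w * (1 / (\<gamma> * cv) * \<tau> w * d_x S w - d_x \<tau> w))"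

lemma open_domain: "open \<Omega>"
  and C2: "C2_on \<Omega> \<tau>" "C2_on \<Omega> u" "C2_on \<Omega> S"
  using sol by (auto simp: smooth_euler_solution_def)

lemma C1: "C1_on \<Omega> \<tau>" "C1_on \<Omega> u" "C1_on \<Omega> S" "C1_on \<Omega> (d_x \<tau>)" "C1_on \<Omega> (d_x u)" "C1_on \<Omega> (d_x S)"
  using C2 by (auto simp: C2_on_def)

lemma
  assumes "w \<in> \<Omega>"
  shows \<tau>_pos: "\<tau> w > 0" and mass: "d_t \<tau> w = d_x u w" and momentum: "d_t u w = - d_x p w"
    and entropy: "d_t S w = 0" and c_pos: "c w > 0"
    and p_eq: "p w = (c w)\<^sup>2 * \<tau> w / \<gamma>"
proof -
  show *: "\<tau> w > 0" "d_t \<tau> w = d_x u w" "d_t u w = - d_x p w" "d_t S w = 0"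
    using sol assms smooth_solution_entropy[OF K cv \<gamma> sol assms]
    by (auto simp: smooth_euler_solution_def add_eq_0_iff)
  show "c w > 0" "p w = (c w)\<^sup>2 * \<tau> w / \<gamma>"
    using wave_speed_square[OF K \<gamma> *(1), of cv "S w"] * \<gamma> by (simp_all add: c_field_def p_field_def)
qed

lemma
  assumes w: "w \<in> \<Omega>"
  shows d_t_p: "d_t p w = - (c w)\<^sup>2 * d_x u w" and d_x_p: "d_x p w = c w * g w"
proof -
  obtain t x where tx: "w = (t, x)" by (cases w)
  note D = C1(1,3)[THEN C1_onD(1), OF w[unfolded tx]] C1(1,3)[THEN C1_onD(2), OF w[unfolded tx]]
  note pd = pressure_deriv[OF D(1,2), THEN DERIV_imp_deriv] pressure_deriv[OF D(3,4), THEN DERIV_imp_deriv]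
  have px: "d_t p w = p w * (d_t S w / cv - \<gamma> * d_t \<tau> w / \<tau> w)"
    "d_x p w = p w * (d_x S w / cv - \<gamma> * d_x \<tau> w / \<tau> w)"
    using pd \<tau>_pos[OF w]
    by (simp_all add: tx p_field_def d_t_def[of "\<lambda>w. pressure K cv \<gamma> (\<tau> w) (S w)"]
        d_x_def[of "\<lambda>w. pressure K cv \<gamma> (\<tau> w) (S w)"])
  show "d_t p w = - (c w)\<^sup>2 * d_x u w" "d_x p w = c w * g w"
    using \<tau>_pos[OF w] \<gamma> cv unfolding px p_eq[OF w] mass[OF w] entropy[OF w] g_def
    by (simp_all add: field_simps power2_eq_square)
qed

text \<open>Since \<open>p\<^sub>t = - c\<^sup>2 u\<^sub>x\<close> and \<open>p\<^sub>x = c g\<close>, dividing the characteristic derivatives of \<open>p\<close> by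
  \<open>- c\<^sup>2\<close> leaves exactly \<open>u\<^sub>x \<plusminus> g\<close>.\<close>

lemma alpha_via_g: "w \<in> \<Omega> \<Longrightarrow> alpha K cv \<gamma> \<tau> S w = d_x u w + g w"
  and beta_via_g: "w \<in> \<Omega> \<Longrightarrow> beta K cv \<gamma> \<tau> S w = d_x u w - g w"
  using c_pos[of w]
  by (simp_all add: alpha_def beta_def d_forward_def d_backward_def d_t_p d_x_p
      field_simps power2_eq_square)

lemma
  shows C1_c: "C1_on \<Omega> c"
    and d_t_c: "w \<in> \<Omega> \<Longrightarrow> d_t c w = - (\<gamma> + 1) / 2 * c w * d_x u w / \<tau> w"
    and d_x_c: "w \<in> \<Omega> \<Longrightarrow> d_x c w = c w * (d_x S w / (2 * cv) - (\<gamma> + 1) / 2 * d_x \<tau> w / \<tau> w)"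
proof -
  define q where "q = - ((\<gamma> + 1) / 2)"
  define E where "E = (\<lambda>w. exp (S w / (2 * cv)))"
  define T where "T = (\<lambda>w. sqrt (K * \<gamma>) * \<tau> w powr q)"
  \<comment> \<open>The wave speed is a function of the entropy alone times a function of the volume alone.\<close>
  have c: "c w = E w * T w" if "w \<in> \<Omega>" for w
    using wave_speed_tau[OF K \<gamma> \<tau>_pos[OF that]] by (simp add: c_field_def E_def T_def q_def)
  have dE: "((\<lambda>s. exp (s / (2 * cv))) has_real_derivative exp (s / (2 * cv)) / (2 * cv)) (at s)" for s
    using cv by (auto intro!: derivative_eq_intros)
  have cE: "continuous_on (S ` \<Omega>) (\<lambda>s. exp (s / (2 * cv)) / (2 * cv))"
    using cv by (intro continuous_intros) auto
  note E = C1_on_compose[OF open_domain C1(3) dE cE, folded E_def]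
    d_t_compose[OF open_domain C1(3) dE cE, folded E_def]
    d_x_compose[OF open_domain C1(3) dE cE, folded E_def]
  have dT: "((\<lambda>s. sqrt (K * \<gamma>) * s powr q) has_real_derivative
      sqrt (K * \<gamma>) * (q * \<tau> w powr (q - 1))) (at (\<tau> w))" if "w \<in> \<Omega>" for w
    using \<tau>_pos[OF that] by (intro DERIV_cmult has_real_derivative_powr)
  have cT: "continuous_on (\<tau> ` \<Omega>) (\<lambda>s. sqrt (K * \<gamma>) * (q * s powr (q - 1)))"
    using \<tau>_pos by (intro continuous_intros) fastforce
  have T: "C1_on \<Omega> T"
    "\<And>w. w \<in> \<Omega> \<Longrightarrow> d_t T w = sqrt (K * \<gamma>) * (q * \<tau> w powr (q - 1)) * d_t \<tau> w"
    "\<And>w. w \<in> \<Omega> \<Longrightarrow> d_x T w = sqrt (K * \<gamma>) * (q * \<tau> w powr (q - 1)) * d_x \<tau> w"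
    unfolding T_def
    using C1_on_compose[OF open_domain C1(1) dT cT] d_t_compose[OF open_domain C1(1) dT cT]
      d_x_compose[OF open_domain C1(1) dT cT] by simp_all
  have ET: "C1_on \<Omega> (\<lambda>w. E w * T w)"
    by (rule C1_on_mult[OF open_domain E(1) T(1)])
  show "C1_on \<Omega> c" using C1_on_cong[OF open_domain c ET] .
  assume w: "w \<in> \<Omega>"
  have T': "sqrt (K * \<gamma>) * (q * \<tau> w powr (q - 1)) = q * T w / \<tau> w"
    using \<tau>_pos[OF w] by (simp add: T_def powr_diff)
  have E': "exp (S w / (2 * cv)) = E w" by (simp add: E_def)
  have dc: "d_t c w = d_t (\<lambda>w. E w * T w) w" "d_x c w = d_x (\<lambda>w. E w * T w) w"
    using partial_derivatives_cong[OF open_domain _ w, of c "\<lambda>w. E w * T w"] c by blast+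
  show "d_t c w = - (\<gamma> + 1) / 2 * c w * d_x u w / \<tau> w"
    unfolding dc d_t_mult[OF open_domain E(1) T(1) w]
      E(2)[OF w] T(2)[OF w] E' T' c[OF w] entropy[OF w] mass[OF w]
    using \<tau>_pos[OF w] by (simp add: q_def field_simps)
  show "d_x c w = c w * (d_x S w / (2 * cv) - (\<gamma> + 1) / 2 * d_x \<tau> w / \<tau> w)"
    unfolding dc d_x_mult[OF open_domain E(1) T(1) w]
      E(3)[OF w] T(3)[OF w] E' T' c[OF w]
    using \<tau>_pos[OF w] by (simp add: q_def field_simps)
qed

section \<open>Derivatives of the gradient variables\<close>

text \<open>Commuting derivatives gives \<open>\<tau>\<^sub>x\<^sub>t = \<tau>\<^sub>t\<^sub>x = u\<^sub>x\<^sub>x\<close> by conservation of mass and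
  \<open>S\<^sub>x\<^sub>t = S\<^sub>t\<^sub>x = 0\<close> because the entropy is constant in time.  The only second derivative
  left in \<open>g\<^sub>t\<close> is therefore \<open>- c u\<^sub>x\<^sub>x\<close>.\<close>

lemma
  shows C1_g: "C1_on \<Omega> g"
    and d_t_g: "w \<in> \<Omega> \<Longrightarrow> d_t g w
      = d_t c w * g w / c w + c w * (d_x u w * d_x S w / (\<gamma> * cv) - d_x (d_x u) w)"
proof -
  note op = open_domain
  \<comment> \<open>A single letter for the constant keeps it one factor under the product rule.\<close>
  define k where "k = 1 / (\<gamma> * cv)"
  have g: "g = (\<lambda>w. c w * (k * \<tau> w * d_x S w - d_x \<tau> w))"
    by (simp add: g_def k_def)
  have 1: "C1_on \<Omega> (\<lambda>w. k * \<tau> w)" by (intro C1_on_mult op C1 C1_on_const)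
  have 2: "C1_on \<Omega> (\<lambda>w. k * \<tau> w * d_x S w)" by (intro C1_on_mult op C1 1)
  have 3: "C1_on \<Omega> (\<lambda>w. k * \<tau> w * d_x S w - d_x \<tau> w)" by (intro C1_on_diff op C1 2)
  show "C1_on \<Omega> g" unfolding g by (intro C1_on_mult op C1_c 3)
  assume w: "w \<in> \<Omega>"
  have t: "d_t (d_x \<tau>) w = d_x (d_x u) w"
    using mixed_partials_commute[OF op C2(1) w] d_x_cong[OF op mass w] by simp
  have s: "d_t (d_x S) w = 0"
    using mixed_partials_commute[OF op C2(3) w] d_x_cong[OF op entropy w] by (simp add: d_x_const)
  have "d_t g w = d_t c w * (k * \<tau> w * d_x S w - d_x \<tau> w)
      + c w * (k * d_x u w * d_x S w - d_x (d_x u) w)"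
    unfolding g d_t_mult[OF op C1_c 3 w] d_t_diff[OF op 2 C1(4) w]
      d_t_mult[OF op 1 C1(6) w] d_t_mult[OF op C1_on_const C1(1) w] t s mass[OF w] d_t_const
    by simp
  then show "d_t g w = d_t c w * g w / c w + c w * (d_x u w * d_x S w / (\<gamma> * cv) - d_x (d_x u) w)"
    using c_pos[OF w] by (simp add: g k_def)
qed

text \<open>This is the \<open>x\<close>-derivative of the momentum equation \<open>u\<^sub>t = - c g\<close>, with \<open>u\<^sub>t\<^sub>x = u\<^sub>x\<^sub>t\<close>.\<close>

lemma d_t_d_x_u:
  assumes w: "w \<in> \<Omega>"
  shows "d_t (d_x u) w = - (d_x c w * g w + c w * d_x g w)"
proof -
  note op = open_domain
  have "d_t (d_x u) w = d_x (\<lambda>w. 0 - c w * g w) w"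
    unfolding mixed_partials_commute[OF op C2(2) w]
    by (rule d_x_cong[OF op _ w]) (simp add: momentum d_x_p)
  also have "\<dots> = - (d_x c w * g w + c w * d_x g w)"
    unfolding d_x_diff[OF op C1_on_const C1_on_mult[OF op C1_c C1_g] w] d_x_const
      d_x_mult[OF op C1_c C1_g w] by simp
  finally show ?thesis .
qed

text \<open>Eliminating \<open>\<tau>\<^sub>x\<close> from \<open>c\<^sub>x\<close> in favour of \<open>g\<close> leaves, besides \<open>g\<close>, only the entropy gradient;
  the coefficient of \<open>c S\<^sub>x / cv\<close> is \<open>1 / 2 - (\<gamma> + 1) / (2 \<gamma>) = - 1 / (2 \<gamma>)\<close>.\<close>

lemma d_x_c_via_g:
  assumes w: "w \<in> \<Omega>"
  shows "d_x c w = (\<gamma> + 1) / (2 * \<tau> w) * g w - c w * d_x S w / (2 * \<gamma> * cv)"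
  using \<tau>_pos[OF w] \<gamma> cv unfolding d_x_c[OF w] g_def by (simp add: field_simps)

section \<open>The coefficients and the characteristic equations\<close>

text \<open>The constant \<open>K_tau\<close> inverts the definition of \<open>z\<close>, that is
  \<open>\<tau> = K_tau * z powr (- 2 / (\<gamma> - 1))\<close>, and \<open>K_c K_tau = (\<gamma> - 1) / 2\<close>, so that all powers and
  all dependence on \<open>K\<close> cancel from \<open>k1\<close>.\<close>

lemma k1_via_tau:
  assumes w: "w \<in> \<Omega>"
  shows "k1 K \<gamma> \<tau> w = (\<gamma> + 1) / (4 * \<tau> w)"
proof -
  define A where "A = 2 * sqrt (K * \<gamma>) / (\<gamma> - 1)"
  have A: "A > 0" using K \<gamma> by (simp add: A_def)
  have \<tau>: "\<tau> w > 0" by (rule \<tau>_pos[OF w])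
  have e: "- ((\<gamma> - 1) / 2) * (2 / (\<gamma> - 1)) = - 1"
    "2 / (\<gamma> - 1) * (- ((\<gamma> + 1) / 2)) + 2 / (\<gamma> - 1) = - 1"
    using \<gamma> by (simp_all add: divide_simps) (simp add: algebra_simps)
  have z: "z_field K \<gamma> \<tau> w powr (2 / (\<gamma> - 1)) = A powr (2 / (\<gamma> - 1)) / \<tau> w"
    using A \<tau> unfolding z_field_def A_def[symmetric] powr_mult powr_powr e
    by (simp add: powr_minus divide_inverse)
  have "K_c K \<gamma> * A powr (2 / (\<gamma> - 1)) = sqrt (K * \<gamma>) * A powr (-1)"
    unfolding K_c_def K_tau_def A_def[symmetric] powr_powr mult.assoc powr_add[symmetric] e ..
  also have "\<dots> = (\<gamma> - 1) / 2"
    using A K \<gamma> by (simp add: powr_minus A_def)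
  finally have Kc: "K_c K \<gamma> * A powr (2 / (\<gamma> - 1)) = (\<gamma> - 1) / 2" .
  have k1: "k1 K \<gamma> \<tau> w = (\<gamma> + 1) / (2 * (\<gamma> - 1)) * (K_c K \<gamma> * A powr (2 / (\<gamma> - 1))) / \<tau> w"
    by (simp add: k1_def z mult.assoc mult.commute)
  show ?thesis unfolding k1 Kc using \<gamma> \<tau> by (simp add: field_simps)
qed

text \<open>Here \<open>m\<^sub>x = m S\<^sub>x / (2 cv)\<close> and \<open>m z = 2 c \<tau> / (\<gamma> - 1)\<close>.\<close>

lemma k2_via_entropy:
  assumes w: "w \<in> \<Omega>"
  shows "k2 K cv \<gamma> \<tau> S w = c w * \<tau> w * d_x S w / (\<gamma> * (\<gamma> + 1) * cv)"
proof -
  have *: "(\<gamma> - 1) / \<gamma> * d_x (m_field cv S) w * z_field K \<gamma> \<tau> w = c w * \<tau> w * d_x S w / (\<gamma> * cv)"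
  proof -
    define q where "q = - ((\<gamma> + 1) / 2)"
    have dm: "((\<lambda>s. exp (s / (2 * cv))) has_real_derivative exp (s / (2 * cv)) / (2 * cv)) (at s)" for s
      using cv by (auto intro!: derivative_eq_intros)
    have cm: "continuous_on (S ` \<Omega>) (\<lambda>s. exp (s / (2 * cv)) / (2 * cv))"
      using cv by (intro continuous_intros) auto
    have mx: "d_x (m_field cv S) w = m_field cv S w / (2 * cv) * d_x S w"
      using d_x_compose[OF open_domain C1(3) dm cm w] by (simp add: m_field_def)
    have "- ((\<gamma> - 1) / 2) = q + 1" by (simp add: q_def field_simps)
    then have "\<tau> w powr (- ((\<gamma> - 1) / 2)) = \<tau> w powr q * \<tau> w"
      using \<tau>_pos[OF w] by (simp add: powr_add)
    then have "m_field cv S w * z_field K \<gamma> \<tau> w = 2 / (\<gamma> - 1) * c w * \<tau> w"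
      using wave_speed_tau[OF K \<gamma> \<tau>_pos[OF w]]
      by (simp add: c_field_def m_field_def z_field_def q_def)
    moreover have "(\<gamma> - 1) / \<gamma> * d_x (m_field cv S) w * z_field K \<gamma> \<tau> w
        = (\<gamma> - 1) / \<gamma> * (m_field cv S w * z_field K \<gamma> \<tau> w) * d_x S w / (2 * cv)"
      unfolding mx by simp
    ultimately show ?thesis using \<gamma> cv by simp
  qed
  have k2: "k2 K cv \<gamma> \<tau> S w
      = ((\<gamma> - 1) / \<gamma> * d_x (m_field cv S) w * z_field K \<gamma> \<tau> w) / (\<gamma> + 1)"
    using \<gamma> by (simp add: k2_def)
  show ?thesis unfolding k2 * using \<gamma> cv by (simp add: field_simps)
qed

lemma k1_k2:
  assumes w: "w \<in> \<Omega>"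
  shows "k1 K \<gamma> \<tau> w * k2 K cv \<gamma> \<tau> S w = c w * d_x S w / (4 * \<gamma> * cv)"
  unfolding k1_via_tau[OF w] k2_via_entropy[OF w] using \<tau>_pos[OF w] \<gamma> by simp

text \<open>In \<open>(u\<^sub>x + g)\<^sub>t + c (u\<^sub>x + g)\<^sub>x\<close> the terms \<open>c g\<^sub>x\<close> and \<open>c u\<^sub>x\<^sub>x\<close> cancel, because
  \<open>u\<^sub>x\<^sub>t\<close> contributes \<open>- c g\<^sub>x\<close> and \<open>g\<^sub>t\<close> contributes \<open>- c u\<^sub>x\<^sub>x\<close>.  What is left is quadratic in
  \<open>u\<^sub>x\<close>, \<open>g\<close> and \<open>S\<^sub>x\<close>.  The backward equation is the same computation with the sign of \<open>g\<close>
  and the direction of the wave reversed.\<close>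

lemma riccati:
  assumes w: "w \<in> \<Omega>"
  defines "\<alpha> \<equiv> alpha K cv \<gamma> \<tau> S" and "\<beta> \<equiv> beta K cv \<gamma> \<tau> S"
  shows "d_forward c \<alpha> w = k1 K \<gamma> \<tau> w *
         (k2 K cv \<gamma> \<tau> S w * (3 * \<alpha> w + \<beta> w) + \<alpha> w * \<beta> w - (\<alpha> w)\<^sup>2)"
    and "d_backward c \<beta> w = k1 K \<gamma> \<tau> w *
         (- k2 K cv \<gamma> \<tau> S w * (\<alpha> w + 3 * \<beta> w) + \<alpha> w * \<beta> w - (\<beta> w)\<^sup>2)"
proof -
  note ug = open_domain C1(5) C1_g w
  have \<alpha>: "\<alpha> w = d_x u w + g w" and \<beta>: "\<beta> w = d_x u w - g w"
    using w by (simp_all add: \<alpha>_def \<beta>_def alpha_via_g beta_via_g)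
  \<comment> \<open>From here on \<open>\<tau>\<close> and \<open>S\<^sub>x\<close> enter only through \<open>k1\<close> and \<open>k1 k2\<close>, so the final step is polynomial.\<close>
  have ct: "d_t c w * g w / c w = - 2 * k1 K \<gamma> \<tau> w * d_x u w * g w"
    using c_pos[OF w] \<tau>_pos[OF w] by (simp add: d_t_c[OF w] k1_via_tau[OF w] field_simps)
  have cx: "d_x c w = 2 * k1 K \<gamma> \<tau> w * g w - 2 * (k1 K \<gamma> \<tau> w * k2 K cv \<gamma> \<tau> S w)"
    unfolding k1_k2[OF w] unfolding d_x_c_via_g[OF w] k1_via_tau[OF w]
    using \<tau>_pos[OF w] \<gamma> cv by (simp add: field_simps)
  have s: "c w * (d_x u w * d_x S w / (\<gamma> * cv) - d_x (d_x u) w)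
      = 4 * (k1 K \<gamma> \<tau> w * k2 K cv \<gamma> \<tau> S w) * d_x u w - c w * d_x (d_x u) w"
    unfolding k1_k2[OF w] by (simp add: algebra_simps)
  have d\<alpha>: "d_t \<alpha> w = d_t (d_x u) w + d_t g w" "d_x \<alpha> w = d_x (d_x u) w + d_x g w"
    using d_t_cong[OF open_domain alpha_via_g w] d_x_cong[OF open_domain alpha_via_g w]
    by (simp_all add: \<alpha>_def d_t_add[OF ug] d_x_add[OF ug])
  show "d_forward c \<alpha> w = k1 K \<gamma> \<tau> w *
         (k2 K cv \<gamma> \<tau> S w * (3 * \<alpha> w + \<beta> w) + \<alpha> w * \<beta> w - (\<alpha> w)\<^sup>2)"
    unfolding d_forward_def d\<alpha> d_t_d_x_u[OF w] d_t_g[OF w] ct cx s \<alpha> \<beta>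
    by (simp add: algebra_simps power2_eq_square)
  have d\<beta>: "d_t \<beta> w = d_t (d_x u) w - d_t g w" "d_x \<beta> w = d_x (d_x u) w - d_x g w"
    using d_t_cong[OF open_domain beta_via_g w] d_x_cong[OF open_domain beta_via_g w]
    by (simp_all add: \<beta>_def d_t_diff[OF ug] d_x_diff[OF ug])
  show "d_backward c \<beta> w = k1 K \<gamma> \<tau> w *
         (- k2 K cv \<gamma> \<tau> S w * (\<alpha> w + 3 * \<beta> w) + \<alpha> w * \<beta> w - (\<beta> w)\<^sup>2)"
    unfolding d_backward_def d\<beta> d_t_d_x_u[OF w] d_t_g[OF w] ct cx s \<alpha> \<beta>
    by (simp add: algebra_simps power2_eq_square)
qed

lemma C1_alpha: "C1_on \<Omega> (alpha K cv \<gamma> \<tau> S)" and C1_beta: "C1_on \<Omega> (beta K cv \<gamma> \<tau> S)"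
  by (rule C1_on_cong[OF open_domain alpha_via_g C1_on_add[OF open_domain C1(5) C1_g]]
      C1_on_cong[OF open_domain beta_via_g C1_on_diff[OF open_domain C1(5) C1_g]]; assumption)+

end

theorem theorem1p2:
  fixes K cv \<gamma> :: real
    and \<Omega> :: "(real \<times> real) set"
    and \<tau> u S :: "real \<times> real \<Rightarrow> real"
  assumes "K > 0" and "cv > 0" and "\<gamma> > 1"
    and "smooth_euler_solution K cv \<gamma> \<Omega> \<tau> u S"
  defines "\<alpha> \<equiv> alpha K cv \<gamma> \<tau> S"
    and "\<beta> \<equiv> beta K cv \<gamma> \<tau> S"
    and "c \<equiv> c_field K cv \<gamma> \<tau> S"
  shows "C1_on \<Omega> \<alpha> \<and> C1_on \<Omega> \<beta> \<and>
    (\<forall>w\<in>\<Omega>.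
       d_forward c \<alpha> w = k1 K \<gamma> \<tau> w *
         (k2 K cv \<gamma> \<tau> S w * (3 * \<alpha> w + \<beta> w) + \<alpha> w * \<beta> w - (\<alpha> w)\<^sup>2) \<and>
       d_backward c \<beta> w = k1 K \<gamma> \<tau> w *
         (- k2 K cv \<gamma> \<tau> S w * (\<alpha> w + 3 * \<beta> w) + \<alpha> w * \<beta> w - (\<beta> w)\<^sup>2))"
proof -
  interpret smooth_flow K cv \<gamma> \<Omega> \<tau> u S
    using assms(1-4) by unfold_locales
  show ?thesis
    unfolding \<alpha>_def \<beta>_def c_def using C1_alpha C1_beta riccati by blast
qed

end
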